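(* Let $\alpha=\alpha(t)$, $t\in I_1$, and $\omega=\omega(s)$, $s\in I_2$, be regular planar curves with values in $\mathbb{C}\setminus\{0\}$ ($I_1,I_2$ intervals of $\mathbb{R}$), let $\Phi=\alpha\ast\omega$ be the associated Lagrangian immersion, and let $\rho>0$. Then $\Phi$ has constant mean curvature $|H|\equiv\rho$ if and only if the curvature functions $\kappa_\alpha$ and $\kappa_\omega$ of $\alpha$ and $\omega$ satisfy, respectively, $$\kappa_\alpha^2=\rho^2|\alpha|^2-\lambda,\qquad \kappa_\omega^2=\rho^2|\omega|^2+\lambda,$$ for some $\lambda\in\mathbb{R}$.
   Context: For base points $t_0\in I_1,s_0\in I_2$, $$(\alpha\ast\omega)(t,s)=\left(\int_{s_0}^s\dot\omega(y)\overline{\omega(y)}\,dy-\int_{t_0}^t\alpha'(x)\overline{\alpha(x)}\,dx\, ,\ \alpha(t)\omega(s)\right)\in\mathbb{C}^2,$$ where $'$ and $\dot{}$ denote derivatives in $t$ and $s$; changing base points only changes the map by a translation. It is a Lagrangian immersion (the Kaehler form $-\mathrm{Im}(z_1\bar w_1+z_2\bar w_2)$ pulls back to zero) with induced metric $(|\alpha|^2+|\omega|^2)(|\alpha'|^2dt^2+|\dot\omega|^2ds^2)$. $\kappa_\alpha,\kappa_\omega$ are the signed curvatures of the planar curves. The mean curvature vector is $H=\mathrm{trace}\,\sigma$ (no factor $1/2$), with $\sigma$ the second fundamental form and the trace taken with respect to the induced metric. *)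

theory Defs
  imports "HOL-Analysis.Analysis"
begin

subsection \<open>Planar curves\<close>

text \<open>Derivatives are taken within the parameter interval, so they are one-sided at those
  endpoints that belong to it and ordinary derivatives on its interior.\<close>

definition curve_deriv :: "real set \<Rightarrow> (real \<Rightarrow> 'a::real_normed_vector) \<Rightarrow> real \<Rightarrow> 'a" where
  "curve_deriv I f t = vector_derivative f (at t within I)"

definition nondegenerate_interval :: "real set \<Rightarrow> bool" where
  "nondegenerate_interval I \<longleftrightarrow> is_interval I \<and> interior I \<noteq> {}"

text \<open>Class \<open>C\<^sup>2\<close> is the regularity at which the curvature functions and the mean curvature
  below make sense; smooth regular curves are a special case.\<close>

definition regular_curve :: "real set \<Rightarrow> (real \<Rightarrow> 'a::real_normed_vector) \<Rightarrow> bool" where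
  "regular_curve I f \<longleftrightarrow>
     f differentiable_on I \<and>
     curve_deriv I f differentiable_on I \<and>
     continuous_on I (curve_deriv I (curve_deriv I f)) \<and>
     (\<forall>t\<in>I. curve_deriv I f t \<noteq> 0)"

text \<open>The numerator is the determinant of the real 2-by-2 matrix with columns
  \<open>\<alpha>'\<close> and \<open>\<alpha>''\<close>.\<close>

definition signed_curvature :: "real set \<Rightarrow> (real \<Rightarrow> complex) \<Rightarrow> real \<Rightarrow> real" where
  "signed_curvature I \<alpha> t =
     Im (cnj (curve_deriv I \<alpha> t) * curve_deriv I (curve_deriv I \<alpha>) t)
       / norm (curve_deriv I \<alpha> t) ^ 3"

subsection \<open>Parametrized surfaces in Euclidean space\<close>

text \<open>Surfaces are maps \<open>F t s\<close> on a product \<open>I1 \<times> I2\<close>; the index type \<open>2\<close> labels the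
  two coordinate directions, with \<open>1\<close> standing for \<open>t\<close> and \<open>2\<close> for \<open>s\<close>.\<close>

definition partial_deriv ::
  "real set \<Rightarrow> real set \<Rightarrow> 2 \<Rightarrow> (real \<Rightarrow> real \<Rightarrow> 'a::euclidean_space) \<Rightarrow> real \<Rightarrow> real \<Rightarrow> 'a" where
  "partial_deriv I1 I2 i F t s =
     (if i = 1 then curve_deriv I1 (\<lambda>x. F x s) t else curve_deriv I2 (\<lambda>y. F t y) s)"

definition tangent_plane ::
  "real set \<Rightarrow> real set \<Rightarrow> (real \<Rightarrow> real \<Rightarrow> 'a::euclidean_space) \<Rightarrow> real \<Rightarrow> real \<Rightarrow> 'a set" where
  "tangent_plane I1 I2 F t s = span (range (\<lambda>i. partial_deriv I1 I2 i F t s))"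

definition induced_metric ::
  "real set \<Rightarrow> real set \<Rightarrow> (real \<Rightarrow> real \<Rightarrow> 'a::euclidean_space) \<Rightarrow> real \<Rightarrow> real \<Rightarrow> real^2^2" where
  "induced_metric I1 I2 F t s =
     (\<chi> i j. partial_deriv I1 I2 i F t s \<bullet> partial_deriv I1 I2 j F t s)"

definition normal_component :: "'a::euclidean_space set \<Rightarrow> 'a \<Rightarrow> 'a" where
  "normal_component V x = (THE n. n \<in> V\<^sup>\<bottom> \<and> x - n \<in> V)"

lemma normal_component_ex1:
  fixes V :: "'a::euclidean_space set"
  assumes V: "subspace V"
  shows "\<exists>!n. n \<in> V\<^sup>\<bottom> \<and> x - n \<in> V"
proof -
  have spV: "span V = V"
    using V by (simp add: span_eq_iff)
  obtain y z where y: "y \<in> V" and z: "\<And>w. w \<in> V \<Longrightarrow> orthogonal z w" and x: "x = y + z"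
    using orthogonal_subspace_decomp_exists[of V x] unfolding spV by blast
  show ?thesis
  proof (rule ex1I[of _ z])
    show "z \<in> V\<^sup>\<bottom> \<and> x - z \<in> V"
      using y z x by (auto simp: orthogonal_comp_def orthogonal_commute)
  next
    fix n assume n: "n \<in> V\<^sup>\<bottom> \<and> x - n \<in> V"
    have d: "n - z \<in> V"
      using subspace_diff[OF V y, of "x - n"] n x by simp
    have "orthogonal (n - z) n" "orthogonal (n - z) z"
      using n d z[OF d] by (auto simp: orthogonal_comp_def orthogonal_def inner_commute)
    then have "(n - z) \<bullet> (n - z) = 0"
      by (simp add: orthogonal_def inner_diff_right)
    then show "n = z" by simp
  qed
qed

text \<open>The coefficient \<open>\<sigma>(\<partial>\<^sub>i, \<partial>\<^sub>j)\<close> of the second fundamental form: the ambient connection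
  is flat, so it is the normal part of \<open>\<partial>\<^sub>i \<partial>\<^sub>j F\<close>.\<close>

definition second_fundamental_form ::
  "real set \<Rightarrow> real set \<Rightarrow> (real \<Rightarrow> real \<Rightarrow> 'a::euclidean_space) \<Rightarrow> 2 \<Rightarrow> 2 \<Rightarrow> real \<Rightarrow> real \<Rightarrow> 'a" where
  "second_fundamental_form I1 I2 F i j t s =
     normal_component (tangent_plane I1 I2 F t s)
       (partial_deriv I1 I2 i (partial_deriv I1 I2 j F) t s)"

text \<open>Unnormalized trace \<open>g\<^sup>i\<^sup>j \<sigma>\<^sub>i\<^sub>j\<close>, without a factor 1/2.\<close>

definition mean_curvature_vector ::
  "real set \<Rightarrow> real set \<Rightarrow> (real \<Rightarrow> real \<Rightarrow> 'a::euclidean_space) \<Rightarrow> real \<Rightarrow> real \<Rightarrow> 'a" where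
  "mean_curvature_vector I1 I2 F t s =
     (\<Sum>i\<in>UNIV. \<Sum>j\<in>UNIV.
        matrix_inv (induced_metric I1 I2 F t s) $ i $ j *\<^sub>R
          second_fundamental_form I1 I2 F i j t s)"

subsection \<open>The Lagrangian immersion associated with two planar curves\<close>

text \<open>The target \<open>complex \<times> complex\<close> carries the Euclidean inner product
  \<open>Re (z1 * cnj w1 + z2 * cnj w2)\<close>. The integrals are oriented, so the variable endpoint may
  lie on either side of the base point.\<close>

definition lagrangian_product ::
  "real set \<Rightarrow> real set \<Rightarrow> real \<Rightarrow> real \<Rightarrow> (real \<Rightarrow> complex) \<Rightarrow> (real \<Rightarrow> complex) \<Rightarrow>
     real \<Rightarrow> real \<Rightarrow> complex \<times> complex" where
  "lagrangian_product I1 I2 t0 s0 \<alpha> \<omega> t s =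
     ((LBINT y=s0..s. curve_deriv I2 \<omega> y * cnj (\<omega> y)) -
      (LBINT x=t0..t. curve_deriv I1 \<alpha> x * cnj (\<alpha> x)),
      \<alpha> t * \<omega> s)"

end

theory Submission
  imports Defs
begin

text \<open>Put \<open>R = |\<alpha>|\<^sup>2 + |\<omega>|\<^sup>2\<close>, \<open>u = (-cnj \<alpha>, \<omega>)\<close> and \<open>v = (cnj \<omega>, \<alpha>)\<close>. Then \<open>\<Phi>\<^sub>t = \<alpha>' u\<close> and
  \<open>\<Phi>\<^sub>s = \<omega>' v\<close>, and \<open>u\<close>, \<open>v\<close> are Hermitian orthogonal of squared length \<open>R\<close>; hence the normal
  plane is spanned by \<open>i \<Phi>\<^sub>t\<close> and \<open>i \<Phi>\<^sub>s\<close>. Expanding the second derivatives in the complex basis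
  \<open>\<Phi>\<^sub>t\<close>, \<open>\<Phi>\<^sub>s\<close>, the mixed contributions cancel in the trace, which leaves
  \<open>H = i \<kappa>\<^sub>\<alpha> / (R |\<alpha>'|) \<Phi>\<^sub>t + i \<kappa>\<^sub>\<omega> / (R |\<omega>'|) \<Phi>\<^sub>s\<close> and so \<open>R |H|\<^sup>2 = \<kappa>\<^sub>\<alpha>\<^sup>2 + \<kappa>\<^sub>\<omega>\<^sup>2\<close>. Therefore
  \<open>|H| = \<rho>\<close> says that \<open>\<rho>\<^sup>2 |\<alpha>|\<^sup>2 - \<kappa>\<^sub>\<alpha>\<^sup>2\<close>, a function of \<open>t\<close>, equals \<open>\<kappa>\<^sub>\<omega>\<^sup>2 - \<rho>\<^sup>2 |\<omega>|\<^sup>2\<close>, a function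
  of \<open>s\<close>; both are then constant.\<close>

subsection \<open>Derivatives along an interval\<close>

text \<open>A connected set with more than one point has no isolated points. This non-triviality
  makes derivatives within \<open>I\<close> unique, endpoints included.\<close>

lemma at_within_nondegenerate_interval:
  assumes "nondegenerate_interval I" "x \<in> I"
  shows "at x within I \<noteq> bot"
proof -
  have "I \<noteq> {y}" for y
    using assms(1) by (auto simp: nondegenerate_interval_def)
  moreover have "connected I"
    using assms(1) by (simp add: nondegenerate_interval_def is_interval_connected)
  ultimately have "x islimpt I"
    using assms(2) connected_imp_perfect by blast
  then show ?thesis
    by (simp add: trivial_limit_within)
qed

lemma curve_deriv_eqI:
  assumes "nondegenerate_interval I" "x \<in> I"
    and "(f has_vector_derivative d) (at x within I)"
  shows "curve_deriv I f x = d"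
  unfolding curve_deriv_def
  by (rule vector_derivative_within[OF at_within_nondegenerate_interval[OF assms(1,2)] assms(3)])

text \<open>The derivative within \<open>I\<close> sees only values on \<open>I\<close>. This allows
  differentiating a first derivative whose closed form is known on \<open>I\<close> only.\<close>

lemma curve_deriv_cong:
  assumes "nondegenerate_interval I" "x \<in> I" "\<And>y. y \<in> I \<Longrightarrow> f y = g y"
    and "(g has_vector_derivative d) (at x within I)"
  shows "curve_deriv I f x = d"
  by (rule curve_deriv_eqI[OF assms(1,2) has_vector_derivative_transform[OF assms(2,3,4)]])

lemma has_vector_derivative_curve_deriv:
  assumes "f differentiable_on I" "x \<in> I"
  shows "(f has_vector_derivative curve_deriv I f x) (at x within I)"
  using assms unfolding curve_deriv_def differentiable_on_def
  by (simp add: vector_derivative_works)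

text \<open>If some point of \<open>I\<close> exceeds \<open>x\<close>, it bounds the segment;
  otherwise \<open>x\<close> is the maximum of \<open>I\<close> and serves as \<open>b\<close>
  itself. Below \<open>e\<close>, the set \<open>I\<close> does not pass \<open>b\<close>.\<close>

lemma real_set_upper_segment:
  fixes I :: "real set"
  assumes "c \<in> I" "x \<in> I"
  obtains b e where "b \<in> I" "c \<le> b" "x \<le> b" "x < e" "I \<inter> {..<e} \<subseteq> {..b}"
proof (cases "\<exists>y\<in>I. x < y")
  case True
  then obtain y where "y \<in> I" "x < y" by blast
  then show ?thesis
    using assms by (intro that[of "max c y" y]) (auto simp: max_def)
next
  case False
  then have "I \<inter> {..<x + 1} \<subseteq> {..x}" "c \<le> x"
    using assms by (auto simp: not_less)
  then show ?thesis
    using assms by (intro that[of x "x + 1"]) auto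
qed

lemma real_set_lower_segment:
  fixes I :: "real set"
  assumes "c \<in> I" "x \<in> I"
  obtains a d where "a \<in> I" "a \<le> c" "a \<le> x" "d < x" "I \<inter> {d<..} \<subseteq> {a..}"
proof (cases "\<exists>y\<in>I. y < x")
  case True
  then obtain y where "y \<in> I" "y < x" by blast
  then show ?thesis
    using assms by (intro that[of "min c y" y]) (auto simp: min_def)
next
  case False
  then have "I \<inter> {x - 1<..} \<subseteq> {x..}" "x \<le> c"
    using assms by (auto simp: not_less)
  then show ?thesis
    using assms by (intro that[of x "x - 1"]) auto
qed

text \<open>The fundamental theorem is applied on a compact segment \<open>{a..b}\<close> inside
  \<open>I\<close> that contains \<open>c\<close> and \<open>x\<close> and coincides with
  \<open>I\<close> near \<open>x\<close>. So \<open>I\<close> may be open, half-open or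
  unbounded.\<close>

lemma interval_integral_has_vector_derivative:
  fixes f :: "real \<Rightarrow> 'a::euclidean_space"
  assumes "is_interval I" "c \<in> I" "x \<in> I" "continuous_on I f"
  shows "((\<lambda>u. LBINT y=c..u. f y) has_vector_derivative f x) (at x within I)"
proof -
  obtain b e where b: "b \<in> I" "c \<le> b" "x \<le> b" "x < e" "I \<inter> {..<e} \<subseteq> {..b}"
    using real_set_upper_segment assms(2,3) by blast
  obtain a d where a: "a \<in> I" "a \<le> c" "a \<le> x" "d < x" "I \<inter> {d<..} \<subseteq> {a..}"
    using real_set_lower_segment assms(2,3) by blast
  have sub: "{a..b} \<subseteq> I"
    using mem_is_interval_1_I[OF assms(1) a(1) b(1)] by auto
  have "at x within I = at x within {a..b}"
  proof (rule at_within_nhd)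
    show "x \<in> {d<..<e}" using a b by simp
    have "I \<inter> {d<..<e} \<subseteq> {a..b}"
      using a(5) b(5) by (auto simp: subset_iff)
    then show "I \<inter> {d<..<e} - {x} = {a..b} \<inter> {d<..<e} - {x}"
      using sub by blast
  qed simp
  moreover have "((\<lambda>u. LBINT y=c..u. f y) has_vector_derivative f x) (at x within {a..b})"
    using a b continuous_on_subset[OF assms(4) sub] by (intro interval_integral_FTC2)
  ultimately show ?thesis by (simp only:)
qed

subsection \<open>Hermitian geometry of the target\<close>

definition cscale :: "complex \<Rightarrow> complex \<times> complex \<Rightarrow> complex \<times> complex" where
  "cscale c z = (c * fst z, c * snd z)"

text \<open>The real part is the Euclidean inner product, and minus the imaginary part is the
  Kaehler form.\<close>

definition hermitian :: "complex \<times> complex \<Rightarrow> complex \<times> complex \<Rightarrow> complex" where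
  "hermitian z w = fst z * cnj (fst w) + snd z * cnj (snd w)"

lemma inner_eq_Re_hermitian: "z \<bullet> w = Re (hermitian z w)"
  by (cases z; cases w) (simp add: hermitian_def inner_complex_def)

lemma hermitian_cscale: "hermitian (cscale a z) (cscale b w) = a * cnj b * hermitian z w"
  by (simp add: hermitian_def cscale_def algebra_simps)

lemma hermitian_commute: "hermitian w z = cnj (hermitian z w)"
  by (simp add: hermitian_def mult.commute)

lemma norm_cscale: "norm (cscale c z) = norm c * norm z"
  by (cases z) (simp add: cscale_def norm_Pair norm_mult power_mult_distrib
      real_sqrt_mult flip: distrib_left)

lemma scaleR_eq_cscale: "r *\<^sub>R z = cscale (of_real r) z"
  by (cases z) (simp add: cscale_def scaleR_conv_of_real)

lemma scaleR_add_imaginary_combinations: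
  "c *\<^sub>R (cscale (\<i> * of_real p) z + cscale (\<i> * of_real q) w) +
    d *\<^sub>R (cscale (\<i> * of_real r) z + cscale (\<i> * of_real u) w) =
    cscale (\<i> * of_real (c * p + d * r)) z + cscale (\<i> * of_real (c * q + d * u)) w"
  by (simp add: scaleR_eq_cscale cscale_def algebra_simps)

lemma inner_cscale_orthogonal:
  "hermitian z w = 0 \<Longrightarrow> cscale a z \<bullet> cscale b w = 0"
  by (simp add: inner_eq_Re_hermitian hermitian_cscale)

lemma norm_add_cscale_orthogonal:
  assumes "hermitian z w = 0"
  shows "(norm (cscale a z + cscale b w))\<^sup>2 = (norm a * norm z)\<^sup>2 + (norm b * norm w)\<^sup>2"
  using norm_add_Pythagorean[of "cscale a z" "cscale b w"] inner_cscale_orthogonal[OF assms]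
  by (simp add: orthogonal_def norm_cscale)

lemma normal_component_eqI:
  assumes "subspace V" "n \<in> V\<^sup>\<bottom>" "x - n \<in> V"
  shows "normal_component V x = n"
  unfolding normal_component_def
  using normal_component_ex1[OF assms(1)] assms(2,3) by (intro the1_equality) auto

text \<open>The real span of \<open>z\<close> and \<open>w\<close> is isotropic for the Kaehler
  form, so \<open>\<i>\<close> times either vector is orthogonal to it. Real parts of the
  coefficients are thus tangential and imaginary parts normal.\<close>

lemma normal_component_hermitian_orthogonal:
  assumes "hermitian z w = 0"
  shows "normal_component (span {z, w}) (cscale p z + cscale q w)
       = cscale (\<i> * of_real (Im p)) z + cscale (\<i> * of_real (Im q)) w" (is "_ = ?n")
proof (rule normal_component_eqI)
  have wz: "hermitian w z = 0"
    using assms hermitian_commute[of w z] by simp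
  have real: "Re (hermitian (cscale (\<i> * of_real r) y) y) = 0" for r y
    by (simp add: hermitian_def cscale_def algebra_simps)
  have "?n \<bullet> z = 0"
    using real[of "Im p" z] inner_cscale_orthogonal[OF wz, of _ 1]
    by (simp add: inner_add_left) (simp add: inner_eq_Re_hermitian cscale_def)
  moreover have "?n \<bullet> w = 0"
    using real[of "Im q" w] inner_cscale_orthogonal[OF assms, of _ 1]
    by (simp add: inner_add_left) (simp add: inner_eq_Re_hermitian cscale_def)
  ultimately have "\<And>y. y \<in> {z, w} \<Longrightarrow> orthogonal ?n y"
    by (auto simp: orthogonal_def)
  then have "orthogonal ?n y" if "y \<in> span {z, w}" for y
    using orthogonal_to_span[OF that] by blast
  then show "?n \<in> (span {z, w})\<^sup>\<bottom>"
    by (simp add: orthogonal_comp_def orthogonal_commute)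
  have "cscale p z - cscale (\<i> * of_real (Im p)) z = Re p *\<^sub>R z" for p z
    unfolding scaleR_eq_cscale cscale_def
    by (simp add: prod_eq_iff complex_eq_iff algebra_simps)
  then have "cscale p z + cscale q w - ?n = Re p *\<^sub>R z + Re q *\<^sub>R w"
    by (simp add: add_diff_add)
  then show "cscale p z + cscale q w - ?n \<in> span {z, w}"
    by (simp add: span_add span_base span_scale)
qed simp

subsection \<open>Mean curvature in orthogonal coordinates\<close>

lemma matrix_inv_diagonal_2:
  fixes A :: "real^2^2"
  assumes "A $ 1 $ 2 = 0" "A $ 2 $ 1 = 0" "A $ 1 $ 1 \<noteq> 0" "A $ 2 $ 2 \<noteq> 0"
  shows "matrix_inv A $ 1 $ 1 = 1 / A $ 1 $ 1" "matrix_inv A $ 2 $ 2 = 1 / A $ 2 $ 2"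
    "matrix_inv A $ 1 $ 2 = 0" "matrix_inv A $ 2 $ 1 = 0"
proof -
  \<comment> \<open>\<open>matrix_inv\<close> is a Hilbert choice; exhibiting the inverse
    \<open>B\<close> makes its defining property available.\<close>
  define B :: "real^2^2" where "B = (\<chi> i j. if i = j then 1 / A $ i $ i else 0)"
  have "A ** B = mat 1 \<and> B ** A = mat 1"
    using assms by (simp add: B_def matrix_matrix_mult_def mat_def vec_eq_iff forall_2 sum_2)
  then have "A ** matrix_inv A = mat 1"
    unfolding matrix_inv_def by (metis (mono_tags, lifting) someI_ex)
  then show "matrix_inv A $ 1 $ 1 = 1 / A $ 1 $ 1" "matrix_inv A $ 2 $ 2 = 1 / A $ 2 $ 2"
    "matrix_inv A $ 1 $ 2 = 0" "matrix_inv A $ 2 $ 1 = 0"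
    using assms by (auto simp: matrix_matrix_mult_def mat_def vec_eq_iff forall_2 sum_2 field_simps)
qed

text \<open>The inverse metric is diagonal, so the mixed second derivatives drop out of the trace
  and never have to be computed.\<close>

lemma mean_curvature_vector_orthogonal:
  fixes F :: "real \<Rightarrow> real \<Rightarrow> 'a::euclidean_space"
    and I1 I2 :: "real set"
  defines "D \<equiv> \<lambda>i. partial_deriv I1 I2 i"
  assumes "D 1 F t s \<bullet> D 2 F t s = 0" "D 1 F t s \<noteq> 0" "D 2 F t s \<noteq> 0"
  shows "mean_curvature_vector I1 I2 F t s =
    (1 / (norm (D 1 F t s))\<^sup>2) *\<^sub>R
      normal_component (span {D 1 F t s, D 2 F t s}) (D 1 (D 1 F) t s) +
    (1 / (norm (D 2 F t s))\<^sup>2) *\<^sub>R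
      normal_component (span {D 1 F t s, D 2 F t s}) (D 2 (D 2 F) t s)"
proof -
  let ?g = "induced_metric I1 I2 F t s"
  have g: "?g $ i $ j = D i F t s \<bullet> D j F t s" for i j
    by (simp add: induced_metric_def D_def)
  have "matrix_inv ?g $ 1 $ 1 = 1 / (norm (D 1 F t s))\<^sup>2"
    "matrix_inv ?g $ 2 $ 2 = 1 / (norm (D 2 F t s))\<^sup>2"
    "matrix_inv ?g $ 1 $ 2 = 0" "matrix_inv ?g $ 2 $ 1 = 0"
    using matrix_inv_diagonal_2[of ?g] assms(2-)
    by (simp_all add: g inner_commute power2_norm_eq_inner)
  moreover have "tangent_plane I1 I2 F t s = span {D 1 F t s, D 2 F t s}"
    by (simp add: tangent_plane_def UNIV_2 D_def)
  ultimately show ?thesis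
    by (simp add: mean_curvature_vector_def second_fundamental_form_def sum_2 D_def)
qed

subsection \<open>The Lagrangian product of two curves\<close>

lemma continuous_on_regular_curve:
  fixes f :: "real \<Rightarrow> complex"
  assumes "regular_curve I f"
  shows "continuous_on I (\<lambda>y. curve_deriv I f y * cnj (f y))"
  using assms unfolding regular_curve_def
  by (intro continuous_intros differentiable_imp_continuous_on) auto

lemma lagrangian_product_partial_1:
  assumes "nondegenerate_interval I1" "t0 \<in> I1" "regular_curve I1 \<alpha>" "t \<in> I1"
  shows "partial_deriv I1 I2 1 (lagrangian_product I1 I2 t0 s0 \<alpha> \<omega>) t s =
    cscale (curve_deriv I1 \<alpha> t) (- cnj (\<alpha> t), \<omega> s)"
proof -
  have "((\<lambda>x. LBINT x=t0..x. curve_deriv I1 \<alpha> x * cnj (\<alpha> x)) has_vector_derivative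
      curve_deriv I1 \<alpha> t * cnj (\<alpha> t)) (at t within I1)"
    using assms continuous_on_regular_curve
    by (intro interval_integral_has_vector_derivative) (auto simp: nondegenerate_interval_def)
  moreover have "(\<alpha> has_vector_derivative curve_deriv I1 \<alpha> t) (at t within I1)"
    using assms by (simp add: regular_curve_def has_vector_derivative_curve_deriv)
  \<comment> \<open>The \<open>0\<close> comes from the integral over \<open>\<omega>\<close>, which
    is constant in \<open>x\<close>.\<close>
  ultimately have "((\<lambda>x. lagrangian_product I1 I2 t0 s0 \<alpha> \<omega> x s) has_vector_derivative
      (0 - curve_deriv I1 \<alpha> t * cnj (\<alpha> t), curve_deriv I1 \<alpha> t * \<omega> s)) (at t within I1)"
    unfolding lagrangian_product_def by (intro derivative_intros)
  then show ?thesis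
    using assms by (simp add: partial_deriv_def curve_deriv_eqI cscale_def)
qed

lemma lagrangian_product_partial_2:
  assumes "nondegenerate_interval I2" "s0 \<in> I2" "regular_curve I2 \<omega>" "s \<in> I2"
  shows "partial_deriv I1 I2 2 (lagrangian_product I1 I2 t0 s0 \<alpha> \<omega>) t s =
    cscale (curve_deriv I2 \<omega> s) (cnj (\<omega> s), \<alpha> t)"
proof -
  have "((\<lambda>x. LBINT x=s0..x. curve_deriv I2 \<omega> x * cnj (\<omega> x)) has_vector_derivative
      curve_deriv I2 \<omega> s * cnj (\<omega> s)) (at s within I2)"
    using assms continuous_on_regular_curve
    by (intro interval_integral_has_vector_derivative) (auto simp: nondegenerate_interval_def)
  moreover have "(\<omega> has_vector_derivative curve_deriv I2 \<omega> s) (at s within I2)"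
    using assms by (simp add: regular_curve_def has_vector_derivative_curve_deriv)
  ultimately have "((\<lambda>y. lagrangian_product I1 I2 t0 s0 \<alpha> \<omega> t y) has_vector_derivative
      (curve_deriv I2 \<omega> s * cnj (\<omega> s) - 0, \<alpha> t * curve_deriv I2 \<omega> s)) (at s within I2)"
    unfolding lagrangian_product_def by (intro derivative_intros)
  then show ?thesis
    using assms by (simp add: partial_deriv_def curve_deriv_eqI cscale_def mult.commute)
qed

lemma lagrangian_product_partial_1_1:
  assumes "nondegenerate_interval I1" "t0 \<in> I1" "regular_curve I1 \<alpha>" "t \<in> I1"
  defines "a' \<equiv> curve_deriv I1 \<alpha> t" and "a'' \<equiv> curve_deriv I1 (curve_deriv I1 \<alpha>) t"
  shows "partial_deriv I1 I2 1
      (partial_deriv I1 I2 1 (lagrangian_product I1 I2 t0 s0 \<alpha> \<omega>)) t s =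
    (- (a' * cnj a') - a'' * cnj (\<alpha> t), a'' * \<omega> s)"
proof -
  have 1: "(\<alpha> has_vector_derivative a') (at t within I1)"
    and 2: "(curve_deriv I1 \<alpha> has_vector_derivative a'') (at t within I1)"
    using assms by (simp_all add: regular_curve_def has_vector_derivative_curve_deriv)
  have "((\<lambda>x. (curve_deriv I1 \<alpha> x * - cnj (\<alpha> x), curve_deriv I1 \<alpha> x * \<omega> s))
      has_vector_derivative (a' * - cnj a' + a'' * - cnj (\<alpha> t), a'' * \<omega> s)) (at t within I1)"
    by (auto intro!: derivative_eq_intros 1 2 has_vector_derivative_cnj simp: a'_def)
  then show ?thesis
    using assms(1-4)
    \<comment> \<open>Only the outer derivative is unfolded; the inner one is replaced on
      \<open>I1\<close> by its closed form.\<close>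
    by (subst partial_deriv_def, simp)
       (erule curve_deriv_cong[rotated 3], simp_all add: lagrangian_product_partial_1 cscale_def)
qed

lemma lagrangian_product_partial_2_2:
  assumes "nondegenerate_interval I2" "s0 \<in> I2" "regular_curve I2 \<omega>" "s \<in> I2"
  defines "w' \<equiv> curve_deriv I2 \<omega> s" and "w'' \<equiv> curve_deriv I2 (curve_deriv I2 \<omega>) s"
  shows "partial_deriv I1 I2 2
      (partial_deriv I1 I2 2 (lagrangian_product I1 I2 t0 s0 \<alpha> \<omega>)) t s =
    (w' * cnj w' + w'' * cnj (\<omega> s), w'' * \<alpha> t)"
proof -
  have 1: "(\<omega> has_vector_derivative w') (at s within I2)"
    and 2: "(curve_deriv I2 \<omega> has_vector_derivative w'') (at s within I2)"
    using assms by (simp_all add: regular_curve_def has_vector_derivative_curve_deriv)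
  have "((\<lambda>y. (curve_deriv I2 \<omega> y * cnj (\<omega> y), curve_deriv I2 \<omega> y * \<alpha> t))
      has_vector_derivative (w' * cnj w' + w'' * cnj (\<omega> s), w'' * \<alpha> t)) (at s within I2)"
    by (auto intro!: derivative_eq_intros 1 2 has_vector_derivative_cnj simp: w'_def)
  then show ?thesis
    using assms(1-4)
    by (subst partial_deriv_def, simp)
       (erule curve_deriv_cong[rotated 3], simp_all add: lagrangian_product_partial_2 cscale_def)
qed

text \<open>Both sides are the angular speed of the tangent direction: \<open>f'' / f'\<close> is
  the logarithmic derivative of \<open>f'\<close>, whose imaginary part is the derivative of its
  argument.\<close>

lemma Im_second_deriv_div_deriv:
  "Im (curve_deriv I (curve_deriv I f) t / curve_deriv I f t) =
    signed_curvature I f t * norm (curve_deriv I f t)"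
proof -
  have "Im (q / p) = Im (cnj p * q) / (norm p)\<^sup>2" for p q
    by (subst complex_div_cnj) (simp add: mult.commute flip: of_real_power)
  then show ?thesis
    by (simp add: signed_curvature_def power2_eq_square power3_eq_cube)
qed

theorem mean_curvature_lagrangian_product:
  assumes I1: "nondegenerate_interval I1" "t0 \<in> I1" "regular_curve I1 \<alpha>" "t \<in> I1"
    and I2: "nondegenerate_interval I2" "s0 \<in> I2" "regular_curve I2 \<omega>" "s \<in> I2"
    and "\<alpha> t \<noteq> 0"
  shows "((norm (\<alpha> t))\<^sup>2 + (norm (\<omega> s))\<^sup>2) *
      (norm (mean_curvature_vector I1 I2 (lagrangian_product I1 I2 t0 s0 \<alpha> \<omega>) t s))\<^sup>2 =
    (signed_curvature I1 \<alpha> t)\<^sup>2 + (signed_curvature I2 \<omega> s)\<^sup>2"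
proof -
  define a w where "a = \<alpha> t" and "w = \<omega> s"
  define a' w' where "a' = curve_deriv I1 \<alpha> t" and "w' = curve_deriv I2 \<omega> s"
  define a'' w'' where "a'' = curve_deriv I1 (curve_deriv I1 \<alpha>) t"
    and "w'' = curve_deriv I2 (curve_deriv I2 \<omega>) s"
  define R where "R = (norm a)\<^sup>2 + (norm w)\<^sup>2"
  define k h where "k = signed_curvature I1 \<alpha> t" and "h = signed_curvature I2 \<omega> s"
  define F where "F = lagrangian_product I1 I2 t0 s0 \<alpha> \<omega>"
  define D where "D = (\<lambda>i. partial_deriv I1 I2 i :: (real \<Rightarrow> real \<Rightarrow> complex \<times> complex) \<Rightarrow> _)"
  define z y where "z = D 1 F t s" and "y = D 2 F t s"
  have nz: "a' \<noteq> 0" "w' \<noteq> 0"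
    using I1 I2 by (auto simp: a'_def w'_def regular_curve_def)
  have R: "R > 0"
    using \<open>\<alpha> t \<noteq> 0\<close> by (simp add: R_def a_def add_pos_nonneg)
  \<comment> \<open>Writing \<open>R\<close> as a polynomial in \<open>a\<close>, \<open>w\<close>
    and their conjugates turns the expansions of the second derivatives below into polynomial
    identities.\<close>
  have Rc: "complex_of_real R = a * cnj a + w * cnj w"
    by (simp add: R_def flip: complex_norm_square)
  have Rc0: "a * cnj a + w * cnj w \<noteq> 0"
    using R Rc by (metis of_real_eq_0_iff less_irrefl)
  have z: "z = cscale a' (- cnj a, w)" and y: "y = cscale w' (cnj w, a)"
    using I1 I2 by (simp_all add: z_def y_def D_def F_def a_def w_def a'_def w'_def
      lagrangian_product_partial_1 lagrangian_product_partial_2)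
  have herm: "hermitian z y = 0"
    unfolding z y hermitian_cscale by (simp add: hermitian_def)
  have "norm (- cnj a, w) = sqrt R" "norm (cnj w, a) = sqrt R"
    by (simp_all add: norm_Pair R_def add.commute)
  then have norm: "norm z = norm a' * sqrt R" "norm y = norm w' * sqrt R"
    by (simp_all add: z y norm_cscale)
  have "D 1 (D 1 F) t s = (- (a' * cnj a') - a'' * cnj a, a'' * w)"
    using I1 by (simp add: D_def F_def a_def w_def a'_def a''_def lagrangian_product_partial_1_1)
  \<comment> \<open>The coefficients are the Hermitian projections: \<open>hermitian\<close> of the
    second derivative with \<open>z\<close> and with \<open>y\<close>, divided by the squared norms
    \<open>R |a'|\<^sup>2\<close> and \<open>R |w'|\<^sup>2\<close>.\<close>
  also have "\<dots> = cscale (a'' / a' + a * cnj a' / of_real R) z +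
      cscale (- (a' * cnj a' * w) / (of_real R * w')) y"
    using nz Rc0 unfolding Rc z y cscale_def by (simp add: divide_simps) algebra
  finally have zz: "D 1 (D 1 F) t s = \<dots>" .
  have "D 2 (D 2 F) t s = (w' * cnj w' + w'' * cnj w, w'' * a)"
    using I2 by (simp add: D_def F_def a_def w_def w'_def w''_def lagrangian_product_partial_2_2)
  also have "\<dots> = cscale (- (w' * cnj w' * a) / (of_real R * a')) z +
      cscale (w'' / w' + w * cnj w' / of_real R) y"
    using nz Rc0 unfolding Rc z y cscale_def by (simp add: divide_simps) algebra
  finally have yy: "D 2 (D 2 F) t s = \<dots>" .
  have Im_zz: "Im (a'' / a' + a * cnj a' / of_real R) = k * norm a' + Im (a * cnj a') / R"
    by (simp add: a'_def a''_def k_def Im_second_deriv_div_deriv)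
  have Im_yy: "Im (w'' / w' + w * cnj w' / of_real R) = h * norm w' + Im (w * cnj w') / R"
    by (simp add: w'_def w''_def h_def Im_second_deriv_div_deriv)
  \<comment> \<open>This puts the cross coefficients in terms of \<open>Im (a * cnj a')\<close> and
    \<open>Im (w * cnj w')\<close>, the same quantities as in \<open>Im_zz\<close> and
    \<open>Im_yy\<close>.\<close>
  have Im_cross: "Im (- (p * cnj p * b) / (of_real R * c)) =
      - ((norm p)\<^sup>2 * Im (b * cnj c)) / (R * (norm c)\<^sup>2)" for b c p
  proof -
    have "- (p * cnj p * b) / (of_real R * c) =
        of_real (- (norm p)\<^sup>2 / R) * (b / c)"
      by (simp flip: complex_norm_square)
    also have "\<dots> = of_real (- (norm p)\<^sup>2 / (R * (norm c)\<^sup>2)) * (b * cnj c)"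
      unfolding complex_div_cnj[of b c] by simp
    finally show ?thesis
      by (simp del: of_real_divide of_real_minus of_real_power of_real_mult)
  qed
  have "z \<bullet> y = 0" "z \<noteq> 0" "y \<noteq> 0"
    using herm norm nz R by (auto simp: inner_eq_Re_hermitian)
  then have "mean_curvature_vector I1 I2 F t s =
      (1 / (norm z)\<^sup>2) *\<^sub>R normal_component (span {z, y}) (D 1 (D 1 F) t s) +
      (1 / (norm y)\<^sup>2) *\<^sub>R normal_component (span {z, y}) (D 2 (D 2 F) t s)"
    unfolding z_def y_def D_def
    by (rule mean_curvature_vector_orthogonal)
  also have "\<dots> =
      cscale (\<i> * of_real (1 / (norm z)\<^sup>2 * (k * norm a' + Im (a * cnj a') / R) +
        1 / (norm y)\<^sup>2 * (- ((norm w')\<^sup>2 * Im (a * cnj a')) / (R * (norm a')\<^sup>2)))) z +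
      cscale (\<i> * of_real (1 / (norm z)\<^sup>2 * (- ((norm a')\<^sup>2 * Im (w * cnj w')) / (R * (norm w')\<^sup>2)) +
        1 / (norm y)\<^sup>2 * (h * norm w' + Im (w * cnj w') / R))) y"
    unfolding zz yy normal_component_hermitian_orthogonal[OF herm] Im_zz Im_yy Im_cross
    by (rule scaleR_add_imaginary_combinations)
  \<comment> \<open>Both terms in \<open>Im (a * cnj a')\<close> have absolute coefficient
    \<open>1 / (R\<^sup>2 |a'|\<^sup>2)\<close> and opposite signs, so only the curvature
    survives.\<close>
  also have "1 / (norm z)\<^sup>2 * (k * norm a' + Im (a * cnj a') / R) +
      1 / (norm y)\<^sup>2 * (- ((norm w')\<^sup>2 * Im (a * cnj a')) / (R * (norm a')\<^sup>2)) =
      k / (R * norm a')"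
    using nz R unfolding norm power_mult_distrib
    by (simp add: field_simps power2_eq_square)
  also have "1 / (norm z)\<^sup>2 * (- ((norm a')\<^sup>2 * Im (w * cnj w')) / (R * (norm w')\<^sup>2)) +
      1 / (norm y)\<^sup>2 * (h * norm w' + Im (w * cnj w') / R) = h / (R * norm w')"
    using nz R unfolding norm power_mult_distrib
    by (simp add: field_simps power2_eq_square)
  finally have "(norm (mean_curvature_vector I1 I2 F t s))\<^sup>2 =
      (\<bar>k / (R * norm a')\<bar> * norm z)\<^sup>2 + (\<bar>h / (R * norm w')\<bar> * norm y)\<^sup>2"
    by (simp only: norm_add_cscale_orthogonal[OF herm] norm_mult norm_ii norm_of_real mult_1)
  also have "\<dots> = (k\<^sup>2 + h\<^sup>2) / R"
    using nz R unfolding norm power_mult_distrib power2_abs power_divide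
    by (simp add: field_simps power2_eq_square)
  finally show ?thesis
    using R \<open>\<alpha> t \<noteq> 0\<close> unfolding F_def k_def h_def R_def a_def w_def by simp
qed

theorem corollary3p4:
  fixes \<alpha> \<omega> :: "real \<Rightarrow> complex" and I1 I2 :: "real set" and t0 s0 \<rho> :: real
  assumes "nondegenerate_interval I1" and "nondegenerate_interval I2"
    and "t0 \<in> I1" and "s0 \<in> I2"
    and "regular_curve I1 \<alpha>" and "regular_curve I2 \<omega>"
    and "\<forall>t\<in>I1. \<alpha> t \<noteq> 0" and "\<forall>s\<in>I2. \<omega> s \<noteq> 0"
    and "\<rho> > 0"
  shows "(\<forall>t\<in>I1. \<forall>s\<in>I2.
            norm (mean_curvature_vector I1 I2 (lagrangian_product I1 I2 t0 s0 \<alpha> \<omega>) t s) = \<rho>)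
         \<longleftrightarrow>
         (\<exists>l::real.
            (\<forall>t\<in>I1. (signed_curvature I1 \<alpha> t)\<^sup>2 = \<rho>\<^sup>2 * (norm (\<alpha> t))\<^sup>2 - l) \<and>
            (\<forall>s\<in>I2. (signed_curvature I2 \<omega> s)\<^sup>2 = \<rho>\<^sup>2 * (norm (\<omega> s))\<^sup>2 + l))"
proof -
  let ?f = "\<lambda>t. \<rho>\<^sup>2 * (norm (\<alpha> t))\<^sup>2 - (signed_curvature I1 \<alpha> t)\<^sup>2"
  let ?g = "\<lambda>s. (signed_curvature I2 \<omega> s)\<^sup>2 - \<rho>\<^sup>2 * (norm (\<omega> s))\<^sup>2"
  have "norm (mean_curvature_vector I1 I2 (lagrangian_product I1 I2 t0 s0 \<alpha> \<omega>) t s) = \<rho>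
      \<longleftrightarrow> ?f t = ?g s" if "t \<in> I1" "s \<in> I2" for t s
  proof -
    let ?H = "norm (mean_curvature_vector I1 I2 (lagrangian_product I1 I2 t0 s0 \<alpha> \<omega>) t s)"
    let ?R = "(norm (\<alpha> t))\<^sup>2 + (norm (\<omega> s))\<^sup>2"
    have "?R > 0"
      using assms that by (simp add: add_pos_nonneg)
    \<comment> \<open>Squaring loses nothing because \<open>?H\<close> and \<open>\<rho>\<close> are
      nonnegative.\<close>
    then have "?H = \<rho> \<longleftrightarrow> ?R * ?H\<^sup>2 = ?R * \<rho>\<^sup>2"
      using \<open>\<rho> > 0\<close> by (subst mult_cancel_left) (auto simp: power2_eq_iff_nonneg)
    also have "?R * ?H\<^sup>2 = (signed_curvature I1 \<alpha> t)\<^sup>2 + (signed_curvature I2 \<omega> s)\<^sup>2"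
      using assms that by (intro mean_curvature_lagrangian_product) auto
    finally show ?thesis
      by (auto simp: algebra_simps)
  qed
  then have "(\<forall>t\<in>I1. \<forall>s\<in>I2.
      norm (mean_curvature_vector I1 I2 (lagrangian_product I1 I2 t0 s0 \<alpha> \<omega>) t s) = \<rho>)
      \<longleftrightarrow> (\<forall>t\<in>I1. \<forall>s\<in>I2. ?f t = ?g s)"
    by blast
  \<comment> \<open>Separation of variables: the base points make both intervals nonempty, and the
    constant is the common value of \<open>?f t0\<close> and \<open>?g s0\<close>.\<close>
  also have "\<dots> \<longleftrightarrow> (\<exists>l. (\<forall>t\<in>I1. ?f t = l) \<and> (\<forall>s\<in>I2. ?g s = l))"
    using \<open>t0 \<in> I1\<close> \<open>s0 \<in> I2\<close> by metis
  also have "\<dots> \<longleftrightarrow> (\<exists>l.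
      (\<forall>t\<in>I1. (signed_curvature I1 \<alpha> t)\<^sup>2 = \<rho>\<^sup>2 * (norm (\<alpha> t))\<^sup>2 - l) \<and>
      (\<forall>s\<in>I2. (signed_curvature I2 \<omega> s)\<^sup>2 = \<rho>\<^sup>2 * (norm (\<omega> s))\<^sup>2 + l))"
    by (intro arg_cong[of _ _ Ex] ext conj_cong ball_cong refl) auto
  finally show ?thesis .
qed

end
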